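(* There is an absolute constant $\kappa>0$ such that the following holds. Assume (PD) has a solution and that $0<\psi_p<\infty$, let $\gamma\in(0,1)$, let $\lambda\in\mathbb{R}^n$, $\lambda\ge0$, satisfy $$0<\|\lambda\|<\min\left(1,\frac{\psi_p}{16\max(\tau_p,\tau_d)}\right),$$ and let $\rho=\dfrac{\psi_p}{\max(\tau_p,\tau_d)}$. If $$\epsilon(A,b_\lambda,c_\lambda)\le\kappa\,\sqrt{n\rho}\,\min\left(\sqrt\rho,1\right),$$ then $\mu^{\max}_\lambda>\bar\mu^{\max}_\lambda$, where $$\mu^{\max}_\lambda=\frac{\psi_p\,\epsilon(A,b_\lambda,c_\lambda)}{4n\max(\tau_p,\tau_d)\left(\sqrt n+\epsilon(A,b_\lambda,c_\lambda)\right)},\qquad \bar\mu^{\max}_\lambda=\frac{\epsilon^2(A,b_\lambda,c_\lambda)\,\gamma}{n^2}.$$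
   Context: Vector inequalities are componentwise; $\|\cdot\|$ is the Euclidean norm; $A\in\mathbb{R}^{m\times n}$ ($m\le n$), $b\in\mathbb{R}^m$, $c\in\mathbb{R}^n$. A minimum over an empty index set is $+\infty$. (PD): minimize $c^Tx$ s.t. $Ax=b$, $x\ge 0$; and its dual, maximize $b^Ty$ s.t. $A^Ty+s=c$, $s\ge0$. $\Omega^P$ is the solution set of the primal problem and $$\psi_p=\inf_{x^*\in\Omega^P}\ \min_{i:\,x^*_i\neq0}x^*_i .$$ A solution of (PD) is a triple $(x^*,y^*,s^* )$ with $x^*$ primal optimal and $(y^*,s^* )$ dual optimal. For $\lambda\ge0$, (PD$_\lambda$): minimize $(c+\lambda)^T(x+\lambda)$ s.t. $Ax=b$, $x\ge-\lambda$; and its dual, maximize $(b+A\lambda)^Ty$ s.t. $A^Ty+s=c$, $s\ge-\lambda$. Its set of strictly feasible points is $\mathcal{F}^0_\lambda=\{(x,y,s): Ax=b,\ A^Ty+s=c,\ x+\lambda>0,\ s+\lambda>0\}$. Let $\Omega^P_\lambda$ and $\Omega^D_\lambda$ be the primal and dual solution sets of (PD$_\lambda$), and let $(\mathcal{A}_\lambda,\mathcal{I}_\lambda)$ be the strictly complementary partition of $\{1,\dots,n\}$: $\mathcal{I}_\lambda=\{i: x_i+\lambda_i>0 \text{ for some } x\in\Omega^P_\lambda\}$, $\mathcal{A}_\lambda=\{i: s_i+\lambda_i>0\text{ for some }(y,s)\in\Omega^D_\lambda\}$. With $b_\lambda=b+A\lambda$, $c_\lambda=c+\lambda$, define $$\epsilon(A,b_\lambda,c_\lambda)=\min\Big(\min_{i\in\mathcal{I}_\lambda}\sup_{x\in\Omega^P_\lambda}(x_i+\lambda_i),\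 \min_{i\in\mathcal{A}_\lambda}\sup_{(y,s)\in\Omega^D_\lambda}(s_i+\lambda_i)\Big)>0,\qquad C_2=\frac{n\sqrt n}{\epsilon(A,b_\lambda,c_\lambda)}+n .$$ $\tau_p,\tau_d>0$ are fixed constants depending only on $(A,b,c)$ with the property (such constants exist) that for every $\lambda\ge0$ and every $(x,y,s)\in\mathcal{F}^0_\lambda$ there is a solution $(x^*,y^*,s^* )$ of (PD) with $$\|x-x^*\|<\tau_p\big(C_2\mu_\lambda+4\|\lambda\|\max(\|\lambda\|,1)\big),\qquad \|s-s^*\|<\tau_d\big(C_2\mu_\lambda+4\|\lambda\|\max(\|\lambda\|,1)\big),$$ where $\mu_\lambda=(x+\lambda)^T(s+\lambda)/n$. $\gamma\in(0,1)$ is the parameter of the neighbourhood $\{(x,y,s)\in\mathcal{F}^0_\lambda:(x_i+\lambda_i)(s_i+\lambda_i)\ge\gamma\mu_\lambda,\ i=1,\dots,n\}$ of the perturbed central path. *)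

theory Defs
  imports
    "Jordan_Normal_Form.Matrix"
    "HOL-Library.Extended_Real"
begin

text \<open>
  The dimensions must be quantified inside the main statement, after an absolute constant. Hence
  vectors and matrices carry their dimensions as values, with indices starting at \<open>0\<close>. On these
  vectors \<open>\<le>\<close> is the componentwise order, but \<open><\<close> only means ``\<open>\<le>\<close> and not \<open>\<ge>\<close>'', so strict
  componentwise inequalities are spelled out.
\<close>

definition vnorm :: "real vec \<Rightarrow> real" where
  "vnorm x = sqrt (x \<bullet> x)"

subsection \<open>The unperturbed primal-dual pair\<close>

definition primal_feasible :: "real mat \<Rightarrow> real vec \<Rightarrow> real vec set" where
  "primal_feasible A b = {x \<in> carrier_vec (dim_col A). A *\<^sub>v x = b \<and> 0\<^sub>v (dim_col A) \<le> x}"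

definition dual_feasible :: "real mat \<Rightarrow> real vec \<Rightarrow> (real vec \<times> real vec) set" where
  "dual_feasible A c = {(y, s). y \<in> carrier_vec (dim_row A) \<and> s \<in> carrier_vec (dim_col A) \<and>
     A\<^sup>T *\<^sub>v y + s = c \<and> 0\<^sub>v (dim_col A) \<le> s}"

definition primal_solutions :: "real mat \<Rightarrow> real vec \<Rightarrow> real vec \<Rightarrow> real vec set" where
  "primal_solutions A b c =
     {x. is_arg_min (\<lambda>x. c \<bullet> x) (\<lambda>x. x \<in> primal_feasible A b) x}"

definition dual_solutions :: "real mat \<Rightarrow> real vec \<Rightarrow> real vec \<Rightarrow> (real vec \<times> real vec) set" where
  "dual_solutions A b c =
     {ys. is_arg_max (\<lambda>(y, s). b \<bullet> y) (\<lambda>ys. ys \<in> dual_feasible A c) ys}"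

definition PD_solution ::
    "real mat \<Rightarrow> real vec \<Rightarrow> real vec \<Rightarrow> real vec \<Rightarrow> real vec \<Rightarrow> real vec \<Rightarrow> bool" where
  "PD_solution A b c x y s \<longleftrightarrow> x \<in> primal_solutions A b c \<and> (y, s) \<in> dual_solutions A b c"

text \<open>In \<^typ>\<open>ereal\<close>, the infimum over the empty set is \<open>\<infinity>\<close>; over a nonempty finite set it is the minimum.\<close>

definition psi_p :: "real mat \<Rightarrow> real vec \<Rightarrow> real vec \<Rightarrow> ereal" where
  "psi_p A b c =
     (INF x \<in> primal_solutions A b c. INF i \<in> {i. i < dim_col A \<and> x $ i \<noteq> 0}. ereal (x $ i))"

subsection \<open>The perturbed primal-dual pair\<close>

definition pert_primal_feasible :: "real mat \<Rightarrow> real vec \<Rightarrow> real vec \<Rightarrow> real vec set" where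
  "pert_primal_feasible A b l = {x \<in> carrier_vec (dim_col A). A *\<^sub>v x = b \<and> - l \<le> x}"

definition pert_dual_feasible ::
    "real mat \<Rightarrow> real vec \<Rightarrow> real vec \<Rightarrow> (real vec \<times> real vec) set" where
  "pert_dual_feasible A c l = {(y, s). y \<in> carrier_vec (dim_row A) \<and> s \<in> carrier_vec (dim_col A) \<and>
     A\<^sup>T *\<^sub>v y + s = c \<and> - l \<le> s}"

definition pert_primal_solutions ::
    "real mat \<Rightarrow> real vec \<Rightarrow> real vec \<Rightarrow> real vec \<Rightarrow> real vec set" where
  "pert_primal_solutions A b c l =
     {x. is_arg_min (\<lambda>x. (c + l) \<bullet> (x + l)) (\<lambda>x. x \<in> pert_primal_feasible A b l) x}"

definition pert_dual_solutions ::
    "real mat \<Rightarrow> real vec \<Rightarrow> real vec \<Rightarrow> real vec \<Rightarrow> (real vec \<times> real vec) set" where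
  "pert_dual_solutions A b c l =
     {ys. is_arg_max (\<lambda>(y, s). (b + A *\<^sub>v l) \<bullet> y) (\<lambda>ys. ys \<in> pert_dual_feasible A c l) ys}"

definition pert_strictly_feasible ::
    "real mat \<Rightarrow> real vec \<Rightarrow> real vec \<Rightarrow> real vec \<Rightarrow> (real vec \<times> real vec \<times> real vec) set" where
  "pert_strictly_feasible A b c l =
     {(x, y, s). x \<in> carrier_vec (dim_col A) \<and> y \<in> carrier_vec (dim_row A) \<and>
        s \<in> carrier_vec (dim_col A) \<and> A *\<^sub>v x = b \<and> A\<^sup>T *\<^sub>v y + s = c \<and>
        (\<forall>i < dim_col A. x $ i + l $ i > 0 \<and> s $ i + l $ i > 0)}"

definition inactive_set :: "real mat \<Rightarrow> real vec \<Rightarrow> real vec \<Rightarrow> real vec \<Rightarrow> nat set" where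
  "inactive_set A b c l =
     {i. i < dim_col A \<and> (\<exists>x \<in> pert_primal_solutions A b c l. x $ i + l $ i > 0)}"

definition active_set :: "real mat \<Rightarrow> real vec \<Rightarrow> real vec \<Rightarrow> real vec \<Rightarrow> nat set" where
  "active_set A b c l =
     {i. i < dim_col A \<and> (\<exists>(y, s) \<in> pert_dual_solutions A b c l. s $ i + l $ i > 0)}"

text \<open>
  This is $\epsilon(A, b + A\lambda, c + \lambda)$. It is extended-valued since the suprema are
  infinite when the solution sets are unbounded, which \<open>l \<ge> 0\<close> with some zero entries allows.
\<close>

definition eps :: "real mat \<Rightarrow> real vec \<Rightarrow> real vec \<Rightarrow> real vec \<Rightarrow> ereal" where
  "eps A b c l = min
     (INF i \<in> inactive_set A b c l.
        SUP x \<in> pert_primal_solutions A b c l. ereal (x $ i + l $ i))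
     (INF i \<in> active_set A b c l.
        SUP (y, s) \<in> pert_dual_solutions A b c l. ereal (s $ i + l $ i))"

text \<open>If \<open>eps\<close> is \<open>\<infinity>\<close>, the fraction is \<open>_ / 0 = 0\<close>, its intended limit value.\<close>

definition C2 :: "real mat \<Rightarrow> real vec \<Rightarrow> real vec \<Rightarrow> real vec \<Rightarrow> real" where
  "C2 A b c l =
     real (dim_col A) * sqrt (real (dim_col A)) / real_of_ereal (eps A b c l) + real (dim_col A)"

definition duality_measure :: "real vec \<Rightarrow> real vec \<Rightarrow> real vec \<Rightarrow> real" where
  "duality_measure l x s = ((x + l) \<bullet> (s + l)) / real (dim_vec l)"

definition error_bound_constants ::
    "real mat \<Rightarrow> real vec \<Rightarrow> real vec \<Rightarrow> real \<Rightarrow> real \<Rightarrow> bool" where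
  "error_bound_constants A b c \<tau>\<^sub>p \<tau>\<^sub>d \<longleftrightarrow> \<tau>\<^sub>p > 0 \<and> \<tau>\<^sub>d > 0 \<and>
     (\<forall>l \<in> carrier_vec (dim_col A). 0\<^sub>v (dim_col A) \<le> l \<longrightarrow>
       (\<forall>(x, y, s) \<in> pert_strictly_feasible A b c l. \<exists>x' y' s'.
          PD_solution A b c x' y' s' \<and>
          vnorm (x - x') <
            \<tau>\<^sub>p * (C2 A b c l * duality_measure l x s + 4 * vnorm l * max (vnorm l) 1) \<and>
          vnorm (s - s') <
            \<tau>\<^sub>d * (C2 A b c l * duality_measure l x s + 4 * vnorm l * max (vnorm l) 1)))"

end

theory Submission
  imports Defs
begin

text \<open>
  Write \<open>t = max \<tau>\<^sub>p \<tau>\<^sub>d\<close>, so that $\rho = \psi_p/t$. Since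
  \<open>\<mu>max = \<rho> \<epsilon> / (4 n (sqrt n + \<epsilon>))\<close>, cancelling $\epsilon/n > 0$ turns the claim into
  \<open>4 \<gamma> \<epsilon> (sqrt n + \<epsilon>) < n \<rho>\<close>. The two factors of the bound on $\epsilon$ handle the two summands
  separately: \<open>\<epsilon> \<le> \<kappa> sqrt (n \<rho>) sqrt \<rho>\<close> controls \<open>\<epsilon> sqrt n\<close> by $\kappa n\rho$, and
  \<open>\<epsilon> \<le> \<kappa> sqrt (n \<rho>)\<close> controls $\epsilon^2$ by $\kappa^2 n\rho$. Hence any $\kappa$ with
  $4\kappa + 4\kappa^2 \le 1$ works, for instance $\kappa = 1/8$.

  The cancellation needs $\epsilon$ to be positive and finite. Finiteness is the assumed upper
  bound. Positivity holds because $\epsilon$ is a minimum of finitely many suprema, each taken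
  over a family that has a positive member by the very definition of the index sets
  (lemma \<open>eps_pos\<close>).
\<close>

text \<open>
  Each supremum is positive, and over a finite index set the infimum is either one of them or,
  if there are none, \<open>\<infinity>\<close>; an infinite family of positive values could have infimum \<open>0\<close>.
\<close>

lemma INF_SUP_pos:
  fixes f :: "'i \<Rightarrow> 'a \<Rightarrow> real"
  assumes "finite I" and "\<And>i. i \<in> I \<Longrightarrow> \<exists>x\<in>S. 0 < f i x"
  shows "0 < (INF i\<in>I. SUP x\<in>S. ereal (f i x))"
proof -
  have "0 < (SUP x\<in>S. ereal (f i x))" if "i \<in> I" for i
    using assms(2)[OF that] by (auto simp: less_SUP_iff)
  with assms(1) show ?thesis
    by (induction I rule: finite_induct) (auto simp: top_ereal_def)
qed

lemma eps_pos: "0 < eps A b c l"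
proof -
  have "0 < (INF i \<in> inactive_set A b c l.
      SUP x \<in> pert_primal_solutions A b c l. ereal (x $ i + l $ i))"
    by (rule INF_SUP_pos) (auto simp: inactive_set_def)
  moreover have "0 < (INF i \<in> active_set A b c l.
      SUP ys \<in> pert_dual_solutions A b c l. ereal (snd ys $ i + l $ i))"
    by (rule INF_SUP_pos) (auto simp: active_set_def intro: rev_bexI)
  ultimately show ?thesis
    by (simp add: eps_def case_prod_unfold)
qed

text \<open>
  The arithmetic core, with $r$, $e$, $g$ for $\rho$, $\epsilon$, $\gamma$. Clearing denominators
  leaves \<open>4 g e (sqrt n + e) < n r\<close>; with $\kappa = 1/8$ the left side is at most
  $(4/8 + 4/64)\, n r$.
\<close>

lemma mu_barmax_less_mu_max:
  fixes n r e g :: real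
  assumes n: "0 < n" and r: "0 < r" and e: "0 < e" and g: "0 < g" "g < 1"
    and bound: "e \<le> 1/8 * sqrt (n * r) * min (sqrt r) 1"
  shows "e\<^sup>2 * g / n\<^sup>2 < r * e / (4 * n * (sqrt n + e))"
proof -
  have "e \<le> 1/8 * sqrt (n * r) * sqrt r"
    using bound by (rule order_trans) (use n r in \<open>intro mult_left_mono; simp\<close>)
  also have "\<dots> = r * sqrt n / 8"
    using n r by (simp add: real_sqrt_mult)
  finally have "e * sqrt n \<le> r * sqrt n / 8 * sqrt n"
    using n by (intro mult_right_mono) auto
  also have "\<dots> = n * r / 8"
    using n by simp
  finally have linear: "e * sqrt n \<le> n * r / 8" .
  have "e \<le> 1/8 * sqrt (n * r) * 1"
    using bound by (rule order_trans) (use n r in \<open>intro mult_left_mono; simp\<close>)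
  hence "e\<^sup>2 \<le> (1/8 * sqrt (n * r) * 1)\<^sup>2"
    using e by (intro power_mono) auto
  hence quadratic: "e\<^sup>2 \<le> n * r / 64"
    using n r by (simp add: power_mult_distrib power_divide)
  have "g * (4 * e * (sqrt n + e)) \<le> 1 * (4 * e * (sqrt n + e))"
    using g e n by (intro mult_right_mono) auto
  also have "\<dots> = 4 * (e * sqrt n) + 4 * e\<^sup>2"
    by (simp add: algebra_simps power2_eq_square)
  also have "\<dots> < n * r"
    using linear quadratic mult_pos_pos[OF n r] by linarith
  finally have main: "g * (4 * e * (sqrt n + e)) < n * r" .
  have pos: "0 < 4 * n * (sqrt n + e)"
    using n e by (simp add: add_nonneg_pos)
  have "e\<^sup>2 * g * (4 * n * (sqrt n + e)) = (g * (4 * e * (sqrt n + e))) * (e * n)"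
    by (simp add: power2_eq_square algebra_simps)
  also have "\<dots> < (n * r) * (e * n)"
    using main e n by (intro mult_strict_right_mono) auto
  also have "\<dots> = r * e * n\<^sup>2"
    by (simp add: power2_eq_square)
  finally show ?thesis
    using n pos by (simp add: frac_less_eq divide_less_eq less_divide_eq)
qed

theorem theorem7:
  shows "\<exists>\<kappa>::real. \<kappa> > 0 \<and>
    (\<forall>(m::nat) (n::nat) (A::real mat) (b::real vec) (c::real vec)
        (\<tau>\<^sub>p::real) (\<tau>\<^sub>d::real) (\<gamma>::real) (l::real vec).
      m \<le> n \<longrightarrow> A \<in> carrier_mat m n \<longrightarrow> b \<in> carrier_vec m \<longrightarrow> c \<in> carrier_vec n \<longrightarrow>
      (\<exists>x y s. PD_solution A b c x y s) \<longrightarrow>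
      0 < psi_p A b c \<longrightarrow> psi_p A b c < \<infinity> \<longrightarrow>
      error_bound_constants A b c \<tau>\<^sub>p \<tau>\<^sub>d \<longrightarrow>
      0 < \<gamma> \<longrightarrow> \<gamma> < 1 \<longrightarrow>
      l \<in> carrier_vec n \<longrightarrow> 0\<^sub>v n \<le> l \<longrightarrow>
      (let \<psi> = real_of_ereal (psi_p A b c);
           \<epsilon> = real_of_ereal (eps A b c l);
           \<rho> = \<psi> / max \<tau>\<^sub>p \<tau>\<^sub>d;
           \<mu>max = \<psi> * \<epsilon> / (4 * real n * max \<tau>\<^sub>p \<tau>\<^sub>d * (sqrt (real n) + \<epsilon>));
           \<mu>barmax = \<epsilon>\<^sup>2 * \<gamma> / (real n)\<^sup>2
       in 0 < vnorm l \<longrightarrow>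
          vnorm l < min 1 (\<psi> / (16 * max \<tau>\<^sub>p \<tau>\<^sub>d)) \<longrightarrow>
          eps A b c l \<le> ereal (\<kappa> * sqrt (real n * \<rho>) * min (sqrt \<rho>) 1) \<longrightarrow>
          \<mu>max > \<mu>barmax))"
proof (intro exI[of _ "1/8 :: real"] conjI allI impI)
  fix m n :: nat and A :: "real mat" and b c :: "real vec" and \<tau>\<^sub>p \<tau>\<^sub>d \<gamma> :: real and l :: "real vec"
  assume psi: "0 < psi_p A b c" "psi_p A b c < \<infinity>"
    and tau: "error_bound_constants A b c \<tau>\<^sub>p \<tau>\<^sub>d"
    and gamma: "0 < \<gamma>" "\<gamma> < 1"
  define t where "t = max \<tau>\<^sub>p \<tau>\<^sub>d"
  define \<psi> where "\<psi> = real_of_ereal (psi_p A b c)"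
  define \<epsilon> where "\<epsilon> = real_of_ereal (eps A b c l)"
  have "0 < t"
    using tau by (simp add: error_bound_constants_def t_def less_max_iff_disj)
  moreover have "0 < \<psi>"
    using psi unfolding \<psi>_def by (cases "psi_p A b c") auto
  ultimately have rho: "0 < \<psi> / t"
    by simp
  have "\<epsilon>\<^sup>2 * \<gamma> / (real n)\<^sup>2 < \<psi> * \<epsilon> / (4 * real n * t * (sqrt (real n) + \<epsilon>))"
    if "eps A b c l \<le> ereal (1/8 * sqrt (real n * (\<psi> / t)) * min (sqrt (\<psi> / t)) 1)"
  proof -
    have pos: "0 < \<epsilon>" and bound: "\<epsilon> \<le> 1/8 * sqrt (real n * (\<psi> / t)) * min (sqrt (\<psi> / t)) 1"
      using that eps_pos[of A b c l] unfolding \<epsilon>_def by (cases "eps A b c l"; simp)+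
    \<comment> \<open>For \<open>n = 0\<close> the upper bound is \<open>0\<close>, which positivity of \<open>\<epsilon>\<close> excludes.\<close>
    have "0 < n"
      using pos bound by (cases n) auto
    hence "\<epsilon>\<^sup>2 * \<gamma> / (real n)\<^sup>2 < \<psi> / t * \<epsilon> / (4 * real n * (sqrt (real n) + \<epsilon>))"
      using rho pos gamma bound by (intro mu_barmax_less_mu_max) auto
    also have "\<dots> = \<psi> * \<epsilon> / (4 * real n * t * (sqrt (real n) + \<epsilon>))"
      by (simp add: ac_simps)
    finally show ?thesis .
  qed
  thus "let \<psi> = real_of_ereal (psi_p A b c);
           \<epsilon> = real_of_ereal (eps A b c l);
           \<rho> = \<psi> / max \<tau>\<^sub>p \<tau>\<^sub>d;
           \<mu>max = \<psi> * \<epsilon> / (4 * real n * max \<tau>\<^sub>p \<tau>\<^sub>d * (sqrt (real n) + \<epsilon>));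
           \<mu>barmax = \<epsilon>\<^sup>2 * \<gamma> / (real n)\<^sup>2
       in 0 < vnorm l \<longrightarrow>
          vnorm l < min 1 (\<psi> / (16 * max \<tau>\<^sub>p \<tau>\<^sub>d)) \<longrightarrow>
          eps A b c l \<le> ereal (1/8 * sqrt (real n * \<rho>) * min (sqrt \<rho>) 1) \<longrightarrow>
          \<mu>max > \<mu>barmax"
    unfolding Let_def \<psi>_def \<epsilon>_def t_def by blast
qed simp

end
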